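(* Let $G_1,G_2,\ldots,G_n$ be a finite sequence of pairwise disjoint connected graphs and let $x_i,y_i\in V(G_i)$ for $1\le i\le n$. Let $G=C(G_1,\ldots,G_n)$ be the chain of the graphs $\{G_i\}_{i=1}^n$ with respect to the vertices $\{x_i,y_i\}_{i=1}^n$, obtained by identifying the vertex $y_i$ with the vertex $x_{i+1}$ for $i=1,2,\ldots,n-1$. Then $$ABC_{GG}(C(G_1,\ldots,G_n))<|E(G)|+\sum_{i=1}^{n}ABC_{GG}(G_i)+\sum_{i=1}^{n-1}\sqrt{\frac{|V(G)|-2}{\left(\sum_{t=1}^{i}|V(G_t)|\right)\left(\sum_{t=i+1}^{n}|V(G_t)|\right)}}.$$
   Context: All graphs are finite and simple. For an edge $uv$ of a graph $G$, $n_u(uv,G)$ is the number of vertices of $G$ strictly closer (in graph distance in $G$) to $u$ than to $v$, and $n_v(uv,G)$ is defined analogously; equidistant vertices are not counted. $ABC_{GG}(G)=\sum_{uv\in E(G)}\sqrt{\frac{n_u(uv,G)+n_v(uv,G)-2}{n_u(uv,G)n_v(uv,G)}}$ (Graovac-Ghorbani index).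
   Formalization: It is additionally assumed that some G_i has at least two vertices; if every G_i is a single vertex, the claim reads 0 < 0 for n = 1 and contains the square root of a negative number for n ≥ 2. *)

theory Defs
  imports Complex_Main "Graph_Theory.Graph_Theory"
begin

text \<open>
  Finite simple graphs are the symmetric, loop-free, finite pair digraphs
  (locale \<^locale>\<open>pair_graph\<close>): an undirected edge is a pair of opposite arcs,
  so the edge set of the graph consists of the two-element sets below.
\<close>

definition uedges :: "'a pair_pre_digraph \<Rightarrow> 'a set set" where
  "uedges G = {{u, v} | u v. (u, v) \<in> parcs G}"

definition gdist :: "'a pair_pre_digraph \<Rightarrow> 'a \<Rightarrow> 'a \<Rightarrow> ereal" where
  "gdist G u v = wf_digraph.\<mu> (with_proj G) (\<lambda>_. 1) u v"

text \<open>
  \<open>n_closer G u {u, v}\<close> is $n_u(uv,G)$. Taking the edge as a set makes the summand of the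
  index a function of the undirected edge; lemma \<open>ABC_GG_edge\<close> gives the
  usual form of that summand.
\<close>

definition n_closer :: "'a pair_pre_digraph \<Rightarrow> 'a \<Rightarrow> 'a set \<Rightarrow> nat" where
  "n_closer G u e = card {z \<in> pverts G. \<forall>v \<in> e - {u}. gdist G z u < gdist G z v}"

definition ABC_GG :: "'a pair_pre_digraph \<Rightarrow> real" where
  "ABC_GG G = (\<Sum>e\<in>uedges G.
     sqrt (((\<Sum>u\<in>e. real (n_closer G u e)) - 2) / (\<Prod>u\<in>e. real (n_closer G u e))))"

lemma n_closer_edge:
  assumes "u \<noteq> v"
  shows "n_closer G u {u, v} = card {z \<in> pverts G. gdist G z u < gdist G z v}"
    and "n_closer G v {u, v} = card {z \<in> pverts G. gdist G z v < gdist G z u}"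
  using assms by (simp_all add: n_closer_def insert_Diff_if)

lemma ABC_GG_edge:
  assumes "u \<noteq> v"
  shows "sqrt (((\<Sum>w\<in>{u, v}. real (n_closer G w {u, v})) - 2) /
           (\<Prod>w\<in>{u, v}. real (n_closer G w {u, v}))) =
         sqrt ((real (n_closer G u {u, v}) + real (n_closer G v {u, v}) - 2) /
           (real (n_closer G u {u, v}) * real (n_closer G v {u, v})))"
  using assms by simp

text \<open>
  The chain of \<open>G 1, \<dots>, G n\<close> is the quotient of their (disjoint) union by the equivalence
  relation generated by \<open>y i \<sim> x (i + 1)\<close>; its vertices are the equivalence classes. Since
  \<open>x i = y i\<close> is allowed, a class may contain more than two of the original vertices.
\<close>

definition chain_verts :: "nat \<Rightarrow> (nat \<Rightarrow> 'a pair_pre_digraph) \<Rightarrow> 'a set" where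
  "chain_verts n G = (\<Union>i\<in>{1..n}. pverts (G i))"

definition chain_rel ::
  "nat \<Rightarrow> (nat \<Rightarrow> 'a pair_pre_digraph) \<Rightarrow> (nat \<Rightarrow> 'a) \<Rightarrow> (nat \<Rightarrow> 'a) \<Rightarrow> 'a rel" where
  "chain_rel n G x y = {(u, v). u \<in> chain_verts n G \<and> v \<in> chain_verts n G \<and>
     equivclp (\<lambda>a b. \<exists>i\<in>{1..<n}. a = y i \<and> b = x (Suc i)) u v}"

definition chain ::
  "nat \<Rightarrow> (nat \<Rightarrow> 'a pair_pre_digraph) \<Rightarrow> (nat \<Rightarrow> 'a) \<Rightarrow> (nat \<Rightarrow> 'a) \<Rightarrow> 'a set pair_pre_digraph"
where
  "chain n G x y =
     \<lparr> pverts = chain_verts n G // chain_rel n G x y,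
       parcs = {(chain_rel n G x y `` {u}, chain_rel n G x y `` {v}) | u v i.
                  i \<in> {1..n} \<and> (u, v) \<in> parcs (G i)} \<rparr>"

text \<open>
  No two vertices of the same \<open>G i\<close> are identified: mapping \<open>G j\<close> to \<open>x i\<close> for \<open>j < i\<close>
  and to \<open>y i\<close> for \<open>j > i\<close> is compatible with the identifications.
\<close>

lemma chain_rel_same_graph:
  assumes disj: "\<And>i j. i \<in> {1..n} \<Longrightarrow> j \<in> {1..n} \<Longrightarrow> i \<noteq> j \<Longrightarrow>
      pverts (G i) \<inter> pverts (G j) = {}"
    and xy: "\<And>i. i \<in> {1..n} \<Longrightarrow> x i \<in> pverts (G i) \<and> y i \<in> pverts (G i)"
    and i: "i \<in> {1..n}" and u: "u \<in> pverts (G i)" and v: "v \<in> pverts (G i)"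
    and uv: "(u, v) \<in> chain_rel n G x y"
  shows "u = v"
proof -
  define f where "f w = (if w \<in> pverts (G i) then w
    else if \<exists>j\<in>{1..n}. j < i \<and> w \<in> pverts (G j) then x i else y i)" for w
  have f_in: "f w = w" if "w \<in> pverts (G i)" for w
    using that by (simp add: f_def)
  have f_lt: "f w = x i" if "j \<in> {1..n}" "j < i" "w \<in> pverts (G j)" for j w
    using that disj[of i j] i by (auto simp: f_def)
  have f_gt: "f w = y i" if "j \<in> {1..n}" "i < j" "w \<in> pverts (G j)" for j w
  proof -
    have "w \<notin> pverts (G i)" using that disj[of i j] i by auto
    moreover have "w \<notin> pverts (G k)" if "k \<in> {1..n}" "k < i" for k
      using that \<open>i < j\<close> \<open>j \<in> {1..n}\<close> \<open>w \<in> pverts (G j)\<close> disj[of k j] by auto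
    ultimately show ?thesis by (auto simp: f_def)
  qed
  have step: "f (y j) = f (x (Suc j))" if j: "j \<in> {1..<n}" for j
  proof -
    have j1: "j \<in> {1..n}" and j2: "Suc j \<in> {1..n}" using j by auto
    consider "Suc j < i" | "Suc j = i" | "j = i" | "i < j" by linarith
    then show ?thesis
    proof cases
      case 1
      then show ?thesis using f_lt[OF j1] f_lt[OF j2] xy[OF j1] xy[OF j2] by simp
    next
      case 2
      then show ?thesis using f_lt[OF j1] f_in xy[OF j1] xy[OF j2] by auto
    next
      case 3
      then show ?thesis using f_gt[OF j2] f_in xy[OF j1] xy[OF j2] by auto
    next
      case 4
      then show ?thesis using f_gt[OF j1] f_gt[OF j2] xy[OF j1] xy[OF j2] by simp
    qed
  qed
  have "equivclp (\<lambda>a b. \<exists>i\<in>{1..<n}. a = y i \<and> b = x (Suc i)) u v"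
    using uv by (simp add: chain_rel_def)
  then have "f u = f v"
    by (induction rule: equivclp_induct) (auto simp: step)
  then show ?thesis using f_in u v by simp
qed

lemma equiv_chain_rel: "equiv (chain_verts n G) (chain_rel n G x y)"
  by (rule equivI)
    (auto simp: chain_rel_def refl_on_def intro!: symI transI
      intro: equivclp_sym equivclp_trans)

lemma pair_graph_chain:
  assumes G: "\<And>i. i \<in> {1..n} \<Longrightarrow> pair_graph (G i)"
    and disj: "\<And>i j. i \<in> {1..n} \<Longrightarrow> j \<in> {1..n} \<Longrightarrow> i \<noteq> j \<Longrightarrow>
      pverts (G i) \<inter> pverts (G j) = {}"
    and xy: "\<And>i. i \<in> {1..n} \<Longrightarrow> x i \<in> pverts (G i) \<and> y i \<in> pverts (G i)"
  shows "pair_graph (chain n G x y)"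
proof -
  let ?V = "chain_verts n G" and ?R = "chain_rel n G x y"
  have arc: "u \<in> pverts (G i) \<and> v \<in> pverts (G i) \<and> u \<noteq> v \<and> (v, u) \<in> parcs (G i)"
    if i: "i \<in> {1..n}" and a: "(u, v) \<in> parcs (G i)" for i u v
  proof -
    interpret pair_graph "G i" by (rule G[OF i])
    show ?thesis using a pair_no_loops[OF a] in_arcsD1 in_arcsD2 graph_symmetric by auto
  qed
  have inV: "u \<in> ?V" if "i \<in> {1..n}" "u \<in> pverts (G i)" for i u
    using that by (auto simp: chain_verts_def)
  have finV: "finite ?V"
    unfolding chain_verts_def
    using G pair_fin_digraph.pair_finite_verts pair_graph_def pair_digraph_def by blast
  have finQ: "finite (?V // ?R)"
    using finV by (simp add: quotient_def)
  have cls: "?R `` {u} \<in> ?V // ?R \<and> ?R `` {v} \<in> ?V // ?R \<and> ?R `` {u} \<noteq> ?R `` {v}"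
    if i: "i \<in> {1..n}" and a: "(u, v) \<in> parcs (G i)" for i u v
  proof -
    have uv: "u \<in> ?V" "v \<in> ?V" using arc[OF that] inV[OF i] by auto
    have "(u, v) \<notin> ?R"
      using chain_rel_same_graph[of n G x y i u v] disj xy i arc[OF that] by blast
    then show ?thesis
      using uv eq_equiv_class[OF _ equiv_chain_rel] by (metis quotientI)
  qed
  have sub: "parcs (chain n G x y) \<subseteq> (?V // ?R) \<times> (?V // ?R)"
    using cls by (auto simp: chain_def)
  have "finite (parcs (chain n G x y))"
    by (rule finite_subset[OF sub]) (simp add: finQ)
  moreover have "sym (parcs (chain n G x y))"
    using arc by (auto simp: chain_def intro!: symI) blast
  ultimately show ?thesis
    using sub finQ cls
    by unfold_locales (auto simp: chain_def symmetric_def)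
qed

end

theory Submission
  imports Defs
begin

text \<open>
  The bound is generous: every summand of the index, in any graph whatsoever, lies in
  $[0, 1)$. With $p = 1/a$ and $q = 1/b$, where $a, b \ge 1$ are the two numbers of closer
  vertices, the radicand is $p + q - 2pq = 1 - (1 - p)(1 - q) - pq < 1$. So the index of a
  graph with at least one edge is strictly below its number of edges
  (\<open>ABC_GG_less_card_uedges\<close>), and for the chain this already gives the leading term
  $|E(G)|$ of the bound. The indices of the parts are nonnegative, and so are the remaining
  square roots, because the chain has at least two vertices.

  The strict inequality requires an edge in the chain: a part with two vertices has an arc,
  being connected, and the chain inherits it.
\<close>

text \<open>
  For $a, b \ge 1$ the strict bound is $(a - 1)(b - 1) \ge 0$ rearranged:
  $a + b - 2 \le ab - 1$. If $a$ or $b$ is $0$, the quotient is $0$ because division by zero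
  yields $0$; including this case makes the bounds uniform in the two counts, whatever the
  distances in the graph are.
\<close>

lemma sqrt_ABC_summand_bounds:
  fixes a b :: nat
  shows "0 \<le> sqrt ((real a + real b - 2) / (real a * real b))"
    and "sqrt ((real a + real b - 2) / (real a * real b)) < 1"
proof -
  show "0 \<le> sqrt ((real a + real b - 2) / (real a * real b))"
    by (cases "a = 0 \<or> b = 0") auto
  show "sqrt ((real a + real b - 2) / (real a * real b)) < 1"
  proof (cases "a = 0 \<or> b = 0")
    case True
    then show ?thesis by auto
  next
    case False
    then have ab: "real a \<ge> 1" "real b \<ge> 1" by auto
    then have "0 \<le> (real a - 1) * (real b - 1)" by simp
    then have "real a + real b - 2 < real a * real b" by (simp add: algebra_simps)
    moreover have "0 < real a * real b" using ab by simp
    ultimately show ?thesis by simp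
  qed
qed

lemma ABC_GG_summand_bounds:
  assumes "pair_graph H" "e \<in> uedges H"
  shows "0 \<le> sqrt (((\<Sum>u\<in>e. real (n_closer H u e)) - 2) / (\<Prod>u\<in>e. real (n_closer H u e)))"
    and "sqrt (((\<Sum>u\<in>e. real (n_closer H u e)) - 2) / (\<Prod>u\<in>e. real (n_closer H u e))) < 1"
proof -
  interpret pair_graph H by (rule assms(1))
  obtain u v where e: "e = {u, v}" and arc: "(u, v) \<in> parcs H"
    using assms(2) unfolding uedges_def by blast
  have "u \<noteq> v" using pair_no_loops[OF arc] by simp
  show "0 \<le> sqrt (((\<Sum>u\<in>e. real (n_closer H u e)) - 2) / (\<Prod>u\<in>e. real (n_closer H u e)))"
    and "sqrt (((\<Sum>u\<in>e. real (n_closer H u e)) - 2) / (\<Prod>u\<in>e. real (n_closer H u e))) < 1"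
    unfolding e ABC_GG_edge[OF \<open>u \<noteq> v\<close>] by (rule sqrt_ABC_summand_bounds)+
qed

lemma ABC_GG_nonneg: "pair_graph H \<Longrightarrow> 0 \<le> ABC_GG H"
  unfolding ABC_GG_def by (intro sum_nonneg ABC_GG_summand_bounds)

lemma finite_uedges:
  assumes "pair_graph H"
  shows "finite (uedges H)"
proof -
  interpret pair_graph H by (rule assms)
  have "uedges H = (\<lambda>(u, v). {u, v}) ` parcs H" by (auto simp: uedges_def)
  then show ?thesis by simp
qed

lemma ABC_GG_less_card_uedges:
  assumes "pair_graph H" "uedges H \<noteq> {}"
  shows "ABC_GG H < real (card (uedges H))"
proof -
  have "ABC_GG H < (\<Sum>e\<in>uedges H. 1)"
    unfolding ABC_GG_def
    using assms by (intro sum_strict_mono finite_uedges ABC_GG_summand_bounds)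
  then show ?thesis by simp
qed

text \<open>
  A walk between two distinct vertices has a first arc.
\<close>

lemma connected_imp_parcs_nonempty:
  assumes "pair_graph H" "connected (with_proj H)" "card (pverts H) \<ge> 2"
  shows "parcs H \<noteq> {}"
proof -
  interpret pair_graph H by (rule assms(1))
  obtain u v where uv: "u \<in> pverts H" "v \<in> pverts H" "u \<noteq> v"
    using assms(3) card_le_Suc0_iff_eq[OF pair_finite_verts] by fastforce
  have "strongly_connected (with_proj H)"
    using symmetric_connected_imp_strongly_connected[OF sym_arcs assms(2)] .
  then have "u \<rightarrow>\<^sup>*\<^bsub>with_proj H\<^esub> v"
    using uv(1,2) by (simp add: strongly_connected_def)
  then show ?thesis
    using uv(3) by (cases rule: converse_reachable_cases) auto
qed

theorem theorem2p8:
  fixes n :: nat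
    and G :: "nat \<Rightarrow> 'a pair_pre_digraph"
    and x y :: "nat \<Rightarrow> 'a"
  assumes "n \<ge> 1"
    and graphs: "\<And>i. i \<in> {1..n} \<Longrightarrow> pair_graph (G i)"
    and conn: "\<And>i. i \<in> {1..n} \<Longrightarrow> connected (with_proj (G i))"
    and disj: "\<And>i j. i \<in> {1..n} \<Longrightarrow> j \<in> {1..n} \<Longrightarrow> i \<noteq> j \<Longrightarrow>
      pverts (G i) \<inter> pverts (G j) = {}"
    and x_in: "\<And>i. i \<in> {1..n} \<Longrightarrow> x i \<in> pverts (G i)"
    and y_in: "\<And>i. i \<in> {1..n} \<Longrightarrow> y i \<in> pverts (G i)"
    and nontrivial: "\<exists>i\<in>{1..n}. card (pverts (G i)) \<ge> 2"
  shows "ABC_GG (chain n G x y) <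
      real (card (uedges (chain n G x y)))
      + (\<Sum>i=1..n. ABC_GG (G i))
      + (\<Sum>i=1..n-1. sqrt ((real (card (pverts (chain n G x y))) - 2) /
           (real (\<Sum>t=1..i. card (pverts (G t))) *
            real (\<Sum>t=i+1..n. card (pverts (G t))))))"
proof -
  let ?C = "chain n G x y"
  interpret C: pair_graph ?C
    using graphs disj x_in y_in by (intro pair_graph_chain) auto
  have C: "pair_graph ?C" by (rule C.pair_graph_axioms)
  obtain i where i: "i \<in> {1..n}" "card (pverts (G i)) \<ge> 2"
    using nontrivial by blast
  obtain u v where "(u, v) \<in> parcs (G i)"
    using connected_imp_parcs_nonempty[OF graphs conn, OF i(1) i(1) i(2)] by auto
  then obtain c d where cd: "(c, d) \<in> parcs ?C"
    using i(1) by (force simp: chain_def)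
  then have "uedges ?C \<noteq> {}" by (auto simp: uedges_def)
  then have edges: "ABC_GG ?C < real (card (uedges ?C))"
    by (rule ABC_GG_less_card_uedges[OF C])
  have "card {c, d} \<le> card (pverts ?C)"
    using cd C.in_arcsD1 C.in_arcsD2 by (intro card_mono) auto
  then have "2 \<le> card (pverts ?C)"
    using C.pair_no_loops[OF cd] by simp
  then have "0 \<le> (\<Sum>i=1..n-1. sqrt ((real (card (pverts ?C)) - 2) /
           (real (\<Sum>t=1..i. card (pverts (G t))) *
            real (\<Sum>t=i+1..n. card (pverts (G t))))))"
    by (intro sum_nonneg real_sqrt_ge_zero divide_nonneg_nonneg mult_nonneg_nonneg of_nat_0_le_iff) auto
  moreover have "0 \<le> (\<Sum>i=1..n. ABC_GG (G i))"
    by (intro sum_nonneg ABC_GG_nonneg graphs)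
  ultimately show ?thesis using edges by linarith
qed

end
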